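(* Let $\Xi$ be a homogeneous Poisson point process in $\mathbb R^d$ with intensity $1$, let the centers $\xi\in\Xi$ have i.i.d. random appetites distributed as a nonnegative random variable $\alpha$ and independent of $\Xi$, and let $\psi$ be the stable allocation of $\mathbb R^d$ to $\Xi$ with these appetites. Let $X=|\psi(0)|$, and let $R^*$ be the radius of the territory of the center at the origin in the Palm version of the model; let $\mathcal E$ and $\mathcal E^*$ be the expectations of the model and of its Palm version. (i) Suppose $d>1$ and $\alpha$ has mean $\mu>2^d$ and (finite) variance $\sigma^2$. Then for every $\delta\in(0,d)$, $$\mathcal E\,X^{d-\delta}<\infty .$$ (ii) Suppose $\alpha$ is bounded from above by a constant $M$ and has mean $\mu<2^{-d}$ and variance $\sigma^2$. Then for every $\varepsilon\in(0,d/2)$ there is some $c>0$ such that $$\mathcal E^*\, e^{c(R^* )^{\varepsilon}}<\infty .$$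
   Context: Setting. Points of $\mathbb R^d$ are called sites; $|\cdot|$ is the Euclidean norm and $\mathcal L$ is Lebesgue measure. $\Xi$ is a homogeneous Poisson point process in $\mathbb R^d$, whose points are called centers; its intensity is $\lambda=\mathbf E\,\#(\Xi\cap[0,1]^d)$. Each center $\xi$ carries a random appetite $\alpha_\xi\ge 0$; the appetites of different centers are i.i.d. with the law of $\alpha$ and independent of $\Xi$. $\mathcal P$, $\mathcal E$ denote the joint law and expectation of centers and appetites. Allocation. An allocation is a map $\psi:\mathbb R^d\to\Xi\cup\{\infty,\Delta\}$ such that $\psi^{-1}(\Delta)$ is $\mathcal L$-null and $\mathcal L[\psi^{-1}(\xi)]\le\alpha_\xi$ for every $\xi\in\Xi$. The set $\psi^{-1}(\xi)$ is the territory of $\xi$; $\xi$ is sated if $\mathcal L[\psi^{-1}(\xi)]=\alpha_\xi$ and unsated if $\mathcal L[\psi^{-1}(\xi)]<\alpha_\xi$. A site $x$ with $\psi(x)=\infty$ is unclaimed. Stability. For a site $x$ and a center $\xi$ with $\psi(x)\notin\{\xi,\Delta\}$, $x$ desires $\xi$ if $|x-\xi|<|x-\psi(x)|$ or $\psi(x)=\infty$. The center $\xi$ covets $x$ if there is $x'\in\psi^{-1}(\xi)$ with $|x-\xi|<|x'-\xi|$, or if $\xi$ is unsated. The pair $(x,\xi)$ is unstable if $x$ desires $\xi$ and $\xi$ covets $x$. The allocation $\psi$ is stable if there are no unstable pairs. Canonical version. Call $A$ an essential subset of $B$ if $\mathcal L(A\setminus B)=0$. $\psi$ is canonical if, whenever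 a site $x$ has a neighborhood that is an essential subset of $\psi^{-1}(\xi)$ for some $\xi\in\Xi\cup\{\infty\}$, then $\psi(x)=\xi$, and otherwise $\psi(x)=\Delta$. It is known that $\mathcal P$-a.s. the stable allocation exists, is unique up to an $\mathcal L$-null set of sites, and has a canonical version; $\psi$ denotes this canonical version. It is translation-equivariant, and $\mathcal P$-a.s. $\psi(0)\neq\Delta$. Quantities. $X=|\psi(0)|$ (with $X=+\infty$ if $\psi(0)=\infty$). The radius of the territory of a center $\xi$ is $R_\psi(\xi)=\operatorname{ess\,sup}_{x\in\psi^{-1}(\xi)}|\xi-x|$ (equal to $0$ if the territory is $\mathcal L$-null). The Palm version of the model, with law $\mathcal P^*$ and expectation $\mathcal E^*$, has center set $\Xi^*=\Xi\cup\{0\}$ (the Poisson process with an added center at the origin), i.i.d. appetites with the law of $\alpha$ at all centers including the origin, independent of $\Xi^*$, and stable allocation $\psi^*$; $R^*=R_{\psi^*}(0)$. *)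

theory Defs
  imports "HOL-Probability.Probability"
begin

section \<open>Stable allocations\<close>

text \<open>
  The values of an allocation: a center, infinity (the site is unclaimed), or the exceptional
  value Delta.
\<close>

datatype 'a target = Center 'a | Infinity | Delta

definition territory :: "('a \<Rightarrow> 'a target) \<Rightarrow> 'a \<Rightarrow> 'a set" where
  "territory \<psi> \<xi> = \<psi> -` {Center \<xi>}"

definition allocation ::
  "'a::euclidean_space set \<Rightarrow> ('a \<Rightarrow> real) \<Rightarrow> ('a \<Rightarrow> 'a target) \<Rightarrow> bool" where
  "allocation \<Xi> app \<psi> \<longleftrightarrow>
     range \<psi> \<subseteq> Center ` \<Xi> \<union> {Infinity, Delta} \<and>
     \<psi> -` {Delta} \<in> null_sets lebesgue \<and>
     (\<forall>\<xi>\<in>\<Xi>. territory \<psi> \<xi> \<in> sets lebesgue \<and>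
             emeasure lebesgue (territory \<psi> \<xi>) \<le> ennreal (app \<xi>))"

definition unsated ::
  "('a::euclidean_space \<Rightarrow> real) \<Rightarrow> ('a \<Rightarrow> 'a target) \<Rightarrow> 'a \<Rightarrow> bool" where
  "unsated app \<psi> \<xi> \<longleftrightarrow> emeasure lebesgue (territory \<psi> \<xi>) < ennreal (app \<xi>)"

definition desires :: "('a::euclidean_space \<Rightarrow> 'a target) \<Rightarrow> 'a \<Rightarrow> 'a \<Rightarrow> bool" where
  "desires \<psi> x \<xi> \<longleftrightarrow>
     \<psi> x \<notin> {Center \<xi>, Delta} \<and>
     ((\<exists>\<eta>. \<psi> x = Center \<eta> \<and> dist x \<xi> < dist x \<eta>) \<or> \<psi> x = Infinity)"

definition covets ::
  "('a::euclidean_space \<Rightarrow> real) \<Rightarrow> ('a \<Rightarrow> 'a target) \<Rightarrow> 'a \<Rightarrow> 'a \<Rightarrow> bool" where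
  "covets app \<psi> \<xi> x \<longleftrightarrow>
     (\<exists>x'\<in>territory \<psi> \<xi>. dist x \<xi> < dist x' \<xi>) \<or> unsated app \<psi> \<xi>"

definition stable_allocation ::
  "'a::euclidean_space set \<Rightarrow> ('a \<Rightarrow> real) \<Rightarrow> ('a \<Rightarrow> 'a target) \<Rightarrow> bool" where
  "stable_allocation \<Xi> app \<psi> \<longleftrightarrow>
     allocation \<Xi> app \<psi> \<and>
     \<not> (\<exists>x. \<exists>\<xi>\<in>\<Xi>. desires \<psi> x \<xi> \<and> covets app \<psi> \<xi> x)"

definition essential_subset :: "'a::euclidean_space set \<Rightarrow> 'a set \<Rightarrow> bool" where
  "essential_subset A B \<longleftrightarrow> A - B \<in> null_sets lebesgue"

definition canonical :: "'a::euclidean_space set \<Rightarrow> ('a \<Rightarrow> 'a target) \<Rightarrow> bool" where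
  "canonical \<Xi> \<psi> \<longleftrightarrow>
     (\<forall>x. let near = (\<lambda>t. \<exists>U. open U \<and> x \<in> U \<and> essential_subset U (\<psi> -` {t})) in
        (\<forall>t \<in> Center ` \<Xi> \<union> {Infinity}. near t \<longrightarrow> \<psi> x = t) \<and>
        ((\<forall>t \<in> Center ` \<Xi> \<union> {Infinity}. \<not> near t) \<longrightarrow> \<psi> x = Delta))"

text \<open>
  The distance from a site to the center it is allocated to, infinite for unclaimed sites.
  The distance to Delta is not specified in the mathematics; it only matters when the site 0 is
  mapped to Delta, which has probability zero, and it is set to 0 here.
\<close>

definition alloc_dist :: "('a::euclidean_space \<Rightarrow> 'a target) \<Rightarrow> 'a \<Rightarrow> ennreal" where
  "alloc_dist \<psi> x =
     (case \<psi> x of Center \<xi> \<Rightarrow> ennreal (dist x \<xi>) | Infinity \<Rightarrow> \<infinity> | Delta \<Rightarrow> 0)"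

text \<open>
  If the territory is a null set, every \<open>z\<close> is an essential upper bound, so the value is
  the least element 0 of \<^typ>\<open>ennreal\<close>.
\<close>

definition territory_radius :: "('a::euclidean_space \<Rightarrow> 'a target) \<Rightarrow> 'a \<Rightarrow> ennreal" where
  "territory_radius \<psi> \<xi> =
     esssup (restrict_space lebesgue (territory \<psi> \<xi>)) (\<lambda>x. ennreal (dist \<xi> x))"

section \<open>Poisson processes with i.i.d. appetites\<close>

text \<open>
  The Poisson law is written out because \<^const>\<open>poisson_pmf\<close> is only specified
  for positive rates, and \<open>B\<close> may be a null set. Independence over the index set
  \<^term>\<open>UNIV :: nat set\<close> is independence of all finite subfamilies.
\<close>

definition poisson_process ::
  "'w measure \<Rightarrow> real \<Rightarrow> ('w \<Rightarrow> 'a::euclidean_space set) \<Rightarrow> bool" where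
  "poisson_process M lam \<Xi> \<longleftrightarrow>
     prob_space M \<and>
     (AE \<omega> in M. \<forall>B. bounded B \<longrightarrow> finite (\<Xi> \<omega> \<inter> B)) \<and>
     (\<forall>B\<in>sets borel. bounded B \<longrightarrow>
        (\<lambda>\<omega>. card (\<Xi> \<omega> \<inter> B)) \<in> measurable M (count_space UNIV) \<and>
        (\<forall>k. measure M {\<omega> \<in> space M. card (\<Xi> \<omega> \<inter> B) = k} =
              (lam * measure lborel B) ^ k / fact k * exp (- (lam * measure lborel B)))) \<and>
     (\<forall>B :: nat \<Rightarrow> 'a set.
        (\<forall>i. B i \<in> sets borel \<and> bounded (B i)) \<and> disjoint_family B \<longrightarrow>
        prob_space.indep_vars M (\<lambda>_. count_space UNIV) (\<lambda>i \<omega>. card (\<Xi> \<omega> \<inter> B i)) UNIV)"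

text \<open>
  The appetites \<open>app \<omega> \<xi>\<close> of the centers \<open>\<xi>\<close> in \<open>\<Xi> \<omega>\<close> are
  i.i.d. with law \<open>D\<close> and independent of the (infinite) point process: for some measurable
  enumeration of the centers, the appetites in the order of the enumeration are an i.i.d. sequence
  independent of the enumeration.
\<close>

definition iid_appetites ::
  "'w measure \<Rightarrow> ('w \<Rightarrow> 'a::euclidean_space set) \<Rightarrow> real measure \<Rightarrow> ('w \<Rightarrow> 'a \<Rightarrow> real) \<Rightarrow> bool" where
  "iid_appetites M \<Xi> D app \<longleftrightarrow>
     (\<exists>x :: nat \<Rightarrow> 'w \<Rightarrow> 'a.
        (\<forall>n. x n \<in> borel_measurable M) \<and>
        (AE \<omega> in M. bij_betw (\<lambda>n. x n \<omega>) UNIV (\<Xi> \<omega>)) \<and>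
        prob_space.indep_vars M (\<lambda>_. borel) (\<lambda>n \<omega>. app \<omega> (x n \<omega>)) UNIV \<and>
        (\<forall>n. distr M borel (\<lambda>\<omega>. app \<omega> (x n \<omega>)) = D) \<and>
        prob_space.indep_set M
          (sets (vimage_algebra (space M) (\<lambda>\<omega> n. x n \<omega>) (PiM UNIV (\<lambda>_. borel))))
          (sets (vimage_algebra (space M) (\<lambda>\<omega> n. app \<omega> (x n \<omega>)) (PiM UNIV (\<lambda>_. borel)))))"

definition stable_model ::
  "'w measure \<Rightarrow> real \<Rightarrow> real measure \<Rightarrow> ('w \<Rightarrow> 'a::euclidean_space set) \<Rightarrow>
     ('w \<Rightarrow> 'a \<Rightarrow> real) \<Rightarrow> ('w \<Rightarrow> 'a \<Rightarrow> 'a target) \<Rightarrow> bool" where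
  "stable_model M lam D \<Xi> app \<psi> \<longleftrightarrow>
     poisson_process M lam \<Xi> \<and>
     iid_appetites M \<Xi> D app \<and>
     (AE \<omega> in M. stable_allocation (\<Xi> \<omega>) (app \<omega>) (\<psi> \<omega>) \<and> canonical (\<Xi> \<omega>) (\<psi> \<omega>))"

text \<open>The center set of the Palm version is \<open>insert 0 (\<Xi> \<omega>)\<close>.\<close>

definition palm_stable_model ::
  "'w measure \<Rightarrow> real \<Rightarrow> real measure \<Rightarrow> ('w \<Rightarrow> 'a::euclidean_space set) \<Rightarrow>
     ('w \<Rightarrow> 'a \<Rightarrow> real) \<Rightarrow> ('w \<Rightarrow> 'a \<Rightarrow> 'a target) \<Rightarrow> bool" where
  "palm_stable_model M lam D \<Xi> app \<psi> \<longleftrightarrow>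
     poisson_process M lam \<Xi> \<and>
     iid_appetites M (\<lambda>\<omega>. insert 0 (\<Xi> \<omega>)) D app \<and>
     (AE \<omega> in M. stable_allocation (insert 0 (\<Xi> \<omega>)) (app \<omega>) (\<psi> \<omega>) \<and>
                 canonical (insert 0 (\<Xi> \<omega>)) (\<psi> \<omega>))"

section \<open>Expectations\<close>

text \<open>
  An increasing function tending to infinity, extended to infinity by its limit. Used for
  powers and exponentials of quantities with values in \<^typ>\<open>ennreal\<close>.
\<close>

definition extend_top :: "(real \<Rightarrow> real) \<Rightarrow> ennreal \<Rightarrow> ennreal" where
  "extend_top f x = (if x = \<infinity> then \<infinity> else ennreal (f (enn2real x)))"

text \<open>
  Measurability of the random variables defined from the allocation is not assumed. Since
  \<^const>\<open>nn_integral\<close> of a nonmeasurable function is a lower integral, the statement that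
  an expectation is finite is expressed with the upper integral; the lemma below shows that it is
  the usual expectation for functions measurable with respect to the completion.
\<close>

definition upper_expectation :: "'w measure \<Rightarrow> ('w \<Rightarrow> ennreal) \<Rightarrow> ennreal" where
  "upper_expectation M f =
     (INF g \<in> {g \<in> borel_measurable M. AE \<omega> in M. f \<omega> \<le> g \<omega>}. \<integral>\<^sup>+ \<omega>. g \<omega> \<partial>M)"

lemma upper_expectation_eq_nn_integral:
  assumes "f \<in> borel_measurable (completion M)"
  shows "upper_expectation M f = (\<integral>\<^sup>+ \<omega>. f \<omega> \<partial>M)"
proof (rule antisym)
  obtain g where g: "g \<in> borel_measurable M" "AE \<omega> in M. f \<omega> = g \<omega>"
    using completion_ex_borel_measurable[OF assms] by blast
  have "upper_expectation M f \<le> (\<integral>\<^sup>+ \<omega>. g \<omega> \<partial>M)"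
    unfolding upper_expectation_def using g by (intro INF_lower) auto
  also have "\<dots> = (\<integral>\<^sup>+ \<omega>. f \<omega> \<partial>M)"
    using g(2) by (intro nn_integral_cong_AE) auto
  finally show "upper_expectation M f \<le> (\<integral>\<^sup>+ \<omega>. f \<omega> \<partial>M)" .
next
  show "(\<integral>\<^sup>+ \<omega>. f \<omega> \<partial>M) \<le> upper_expectation M f"
    unfolding upper_expectation_def by (intro INF_greatest nn_integral_mono_AE) auto
qed

end

theory Submission
  imports Defs
begin

text \<open>
  Stability turns an exceptionally far allocation into an exceptional total appetite.

  If the origin is unclaimed or allocated farther away than \<open>r\<close>, then every center within distance
  \<open>r\<close> is sated with sites that are no farther from it than the origin is. Hence the appetites in the
  ball of radius \<open>r\<close> sum to at most the volume of the ball of radius \<open>2 * r\<close>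
  (\<open>far_site_imp_appetites_le_volume\<close>). If \<open>\<mu> > 2 ^ d\<close>, this is less than the expected
  sum by a constant factor.

  Dually, if the territory of the origin reaches beyond \<open>r\<close>, then the ball of radius \<open>r\<close> is
  consumed by the centers in the ball of radius \<open>2 * r\<close>, so their appetites sum to at least its volume
  (\<open>far_territory_imp_volume_le_appetites\<close>). If \<open>\<mu> < 2 ^ (- d)\<close>, this is more than the
  expected sum by a constant factor, up to the appetite of the origin.

  In both cases the sum is compound Poisson, with explicit exponential moments
  (\<open>iid_appetite_sum_laplace\<close>, \<open>expectation_power_poisson_count\<close>). A lower deviation needs only
  a second moment of the appetites, as these are nonnegative; for an upper deviation they are bounded. The
  Chernoff bound therefore gives a probability of order \<open>exp (- \<kappa> * r ^ d)\<close> for either event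
  (\<open>poisson_appetite_sum_tail\<close>), and summing over integer radii bounds the expectation of
  \<open>exp (c * r ^ d)\<close> for some \<open>c > 0\<close> (\<open>moment_of_appetite_sum_deviation\<close>). This
  dominates both functions of the distance whose expectation is to be finite.
\<close>

section \<open>Far allocations force exceptional appetites\<close>

text \<open>
  A site that is unclaimed or allocated farther away than \<open>r\<close> desires every center within
  distance \<open>r\<close>, so stability says that none of these centers covets it. Each of them is
  therefore sated, and its territory reaches no farther from it than \<open>x\<close> does. The disjoint
  territories, whose volumes are the full appetites, then fit into the ball of radius
  \<open>2 * r\<close>.
\<close>

lemma far_site_imp_appetites_le_volume:
  fixes \<Xi> :: "'a::euclidean_space set"
  assumes st: "stable_allocation \<Xi> app \<psi>" and fin: "finite (\<Xi> \<inter> cball x r)"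
    and r: "0 \<le> r" and far: "ennreal r < alloc_dist \<psi> x"
  shows "(\<Sum>\<xi>\<in>\<Xi> \<inter> cball x r. app \<xi>) \<le> measure lborel (cball x (2 * r))"
proof -
  have alloc: "allocation \<Xi> app \<psi>"
    and no: "\<And>x \<xi>. \<xi> \<in> \<Xi> \<Longrightarrow> desires \<psi> x \<xi> \<Longrightarrow> \<not> covets app \<psi> \<xi> x"
    using st by (auto simp: stable_allocation_def)
  have not_coveted: "\<not> covets app \<psi> \<xi> x" if "\<xi> \<in> \<Xi> \<inter> cball x r" for \<xi>
  proof -
    have "desires \<psi> x \<xi>"
      using that far r by (cases "\<psi> x") (auto simp: desires_def alloc_dist_def ennreal_less_iff)
    then show ?thesis using no that by blast
  qed
  have sated: "emeasure lebesgue (territory \<psi> \<xi>) = ennreal (app \<xi>)"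
    if "\<xi> \<in> \<Xi> \<inter> cball x r" for \<xi>
    using not_coveted[OF that] alloc that
    by (auto simp: covets_def unsated_def allocation_def not_less intro: antisym)
  have near: "territory \<psi> \<xi> \<subseteq> cball x (2 * r)" if "\<xi> \<in> \<Xi> \<inter> cball x r" for \<xi>
  proof
    fix y assume "y \<in> territory \<psi> \<xi>"
    then have "dist y \<xi> \<le> dist x \<xi>"
      using not_coveted[OF that] by (auto simp: covets_def not_less)
    then show "y \<in> cball x (2 * r)"
      using that dist_triangle[of x y \<xi>] by (auto simp: dist_commute)
  qed
  have "ennreal (\<Sum>\<xi>\<in>\<Xi> \<inter> cball x r. app \<xi>) \<le> (\<Sum>\<xi>\<in>\<Xi> \<inter> cball x r. ennreal (app \<xi>))"
  proof -
    have "ennreal (\<Sum>\<xi>\<in>\<Xi> \<inter> cball x r. app \<xi>) \<le> ennreal (\<Sum>\<xi>\<in>\<Xi> \<inter> cball x r. max 0 (app \<xi>))"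
      by (intro ennreal_leI sum_mono) auto
    also have "\<dots> = (\<Sum>\<xi>\<in>\<Xi> \<inter> cball x r. ennreal (max 0 (app \<xi>)))"
      by (rule sum_ennreal[symmetric]) auto
    finally show ?thesis by (simp add: ennreal_max_0)
  qed
  also have "\<dots> = (\<Sum>\<xi>\<in>\<Xi> \<inter> cball x r. emeasure lebesgue (territory \<psi> \<xi>))"
    using sated by simp
  also have "\<dots> = emeasure lebesgue (\<Union>\<xi>\<in>\<Xi> \<inter> cball x r. territory \<psi> \<xi>)"
    using alloc fin by (intro sum_emeasure)
      (auto simp: allocation_def disjoint_family_on_def territory_def)
  also have "\<dots> \<le> emeasure lebesgue (cball x (2 * r))"
    using near by (intro emeasure_mono UN_least) auto
  also have "\<dots> = ennreal (measure lborel (cball x (2 * r)))"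
    using r by (simp add: emeasure_cball content_cball)
  finally show ?thesis by (simp add: ennreal_le_iff)
qed

text \<open>
  The dual argument: a center \<open>\<xi>\<close> whose territory reaches beyond \<open>r\<close> covets every
  site within distance \<open>r\<close>, so no such site desires \<open>\<xi>\<close>. Up to the null set of exceptional
  sites, each is allocated to a center at least as near as \<open>\<xi>\<close>, which lies within
  \<open>2 * r\<close> of \<open>\<xi>\<close>. The territories of the centers there cover the small ball.
\<close>

lemma far_territory_imp_volume_le_appetites:
  fixes \<Theta> :: "'a::euclidean_space set"
  assumes st: "stable_allocation \<Theta> app \<psi>" and fin: "finite (\<Theta> \<inter> cball \<xi> (2 * r))"
    and \<xi>: "\<xi> \<in> \<Theta>" and app: "\<And>\<eta>. \<eta> \<in> \<Theta> \<Longrightarrow> 0 \<le> app \<eta>"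
    and r: "0 \<le> r" and far: "ennreal r < territory_radius \<psi> \<xi>"
  shows "measure lborel (cball \<xi> r) \<le> (\<Sum>\<eta>\<in>\<Theta> \<inter> cball \<xi> (2 * r). app \<eta>)"
proof -
  have alloc: "allocation \<Theta> app \<psi>"
    and no: "\<And>x \<xi>. \<xi> \<in> \<Theta> \<Longrightarrow> covets app \<psi> \<xi> x \<Longrightarrow> \<not> desires \<psi> x \<xi>"
    using st by (auto simp: stable_allocation_def)
  obtain z where z: "z \<in> territory \<psi> \<xi>" "r < dist \<xi> z"
  proof (rule ccontr)
    assume "\<not> thesis"
    then have le: "dist \<xi> z \<le> r" if "z \<in> territory \<psi> \<xi>" for z
      using that \<open>\<And>z. \<lbrakk>z \<in> territory \<psi> \<xi>; r < dist \<xi> z\<rbrakk> \<Longrightarrow> thesis\<close> not_less by blast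
    have "territory_radius \<psi> \<xi> \<le> ennreal r"
      unfolding territory_radius_def
    proof (rule esssup_I)
      show "(\<lambda>x. ennreal (dist \<xi> x)) \<in> borel_measurable (restrict_space lebesgue (territory \<psi> \<xi>))"
        by (intro measurable_restrict_space1 measurable_completion) measurable
      show "AE x in restrict_space lebesgue (territory \<psi> \<xi>). ennreal (dist \<xi> x) \<le> ennreal r"
        using le by (intro AE_I2 ennreal_leI) (auto simp: space_restrict_space)
    qed
    then show False using far by simp
  qed
  have cover: "cball \<xi> r \<subseteq> (\<Union>\<eta>\<in>\<Theta> \<inter> cball \<xi> (2 * r). territory \<psi> \<eta>) \<union> \<psi> -` {Delta}"
  proof
    fix y assume y: "y \<in> cball \<xi> r"
    then have "covets app \<psi> \<xi> y"
      unfolding covets_def using z by (auto simp: dist_commute intro!: bexI[of _ z])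
    then have nd: "\<not> desires \<psi> y \<xi>" using no \<xi> by blast
    have ran: "\<psi> y \<in> Center ` \<Theta> \<union> {Infinity, Delta}"
      using alloc by (auto simp: allocation_def)
    show "y \<in> (\<Union>\<eta>\<in>\<Theta> \<inter> cball \<xi> (2 * r). territory \<psi> \<eta>) \<union> \<psi> -` {Delta}"
    proof (cases "\<psi> y")
      case (Center \<eta>)
      then have "dist y \<eta> \<le> dist y \<xi>" "\<eta> \<in> \<Theta>"
        using nd ran by (auto simp: desires_def)
      then show ?thesis
        using Center y dist_triangle[of \<xi> \<eta> y] by (auto simp: territory_def dist_commute)
    qed (use nd in \<open>auto simp: desires_def\<close>)
  qed
  have meas: "territory \<psi> \<eta> \<in> sets lebesgue" if "\<eta> \<in> \<Theta>" for \<eta>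
    using alloc that by (auto simp: allocation_def)
  have null: "\<psi> -` {Delta} \<in> null_sets lebesgue"
    using alloc by (auto simp: allocation_def)
  have "ennreal (measure lborel (cball \<xi> r)) = emeasure lebesgue (cball \<xi> r)"
    using r by (simp add: emeasure_cball content_cball)
  also have "\<dots> \<le> emeasure lebesgue ((\<Union>\<eta>\<in>\<Theta> \<inter> cball \<xi> (2 * r). territory \<psi> \<eta>) \<union> \<psi> -` {Delta})"
    using cover null_setsD2[OF null] meas fin by (intro emeasure_mono sets.Un sets.finite_UN) auto
  also have "\<dots> = emeasure lebesgue (\<Union>\<eta>\<in>\<Theta> \<inter> cball \<xi> (2 * r). territory \<psi> \<eta>)"
    using null meas fin by (intro emeasure_Un_null_set sets.finite_UN) auto
  also have "\<dots> \<le> (\<Sum>\<eta>\<in>\<Theta> \<inter> cball \<xi> (2 * r). emeasure lebesgue (territory \<psi> \<eta>))"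
    using meas fin by (intro emeasure_subadditive_finite) auto
  also have "\<dots> \<le> (\<Sum>\<eta>\<in>\<Theta> \<inter> cball \<xi> (2 * r). ennreal (app \<eta>))"
    using alloc by (intro sum_mono) (auto simp: allocation_def)
  also have "\<dots> = ennreal (\<Sum>\<eta>\<in>\<Theta> \<inter> cball \<xi> (2 * r). app \<eta>)"
    using app by (intro sum_ennreal) auto
  finally show ?thesis
    using app by (subst (asm) ennreal_le_iff) (auto intro!: sum_nonneg)
qed

section \<open>Exponential moments of sums of appetites\<close>

text \<open>
  The probability generating function of the Poisson distribution.
\<close>

lemma expectation_power_poisson_count:
  fixes \<Xi> :: "'w \<Rightarrow> 'a::euclidean_space set"
  assumes pp: "poisson_process M lam \<Xi>" and B: "B \<in> sets borel" "bounded B"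
    and z: "0 \<le> z" and lam: "0 \<le> lam"
  shows "(\<integral>\<^sup>+\<omega>. ennreal z ^ card (\<Xi> \<omega> \<inter> B) \<partial>M) = ennreal (exp (lam * measure lborel B * (z - 1)))"
proof -
  interpret prob_space M using pp by (simp add: poisson_process_def)
  define v where "v = lam * measure lborel B"
  have v: "0 \<le> v" using lam by (simp add: v_def)
  define K where "K \<omega> = card (\<Xi> \<omega> \<inter> B)" for \<omega>
  have [measurable]: "K \<in> measurable M (count_space UNIV)"
    and law: "\<And>k. prob {\<omega> \<in> space M. K \<omega> = k} = v ^ k / fact k * exp (- v)"
    using pp B unfolding poisson_process_def K_def v_def by auto
  have "(\<integral>\<^sup>+\<omega>. ennreal z ^ K \<omega> \<partial>M) =
      (\<integral>\<^sup>+\<omega>. (\<Sum>k. ennreal (z ^ k) * indicator {\<omega> \<in> space M. K \<omega> = k} \<omega>) \<partial>M)"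
  proof (rule nn_integral_cong)
    fix \<omega> assume "\<omega> \<in> space M"
    then have "(\<lambda>k. ennreal (z ^ k) * indicator {\<omega> \<in> space M. K \<omega> = k} \<omega>) =
        (\<lambda>k. if k = K \<omega> then ennreal z ^ k else 0)"
      using z by (auto simp: fun_eq_iff ennreal_power)
    then show "ennreal z ^ K \<omega> = (\<Sum>k. ennreal (z ^ k) * indicator {\<omega> \<in> space M. K \<omega> = k} \<omega>)"
      using sums_unique[OF sums_single[of "K \<omega>" "\<lambda>k. ennreal z ^ k"]] by simp
  qed
  also have "\<dots> = (\<Sum>k. ennreal (z ^ k) * emeasure M {\<omega> \<in> space M. K \<omega> = k})"
    by (subst nn_integral_suminf) (auto simp: nn_integral_cmult)
  also have "\<dots> = (\<Sum>k. ennreal ((z * v) ^ k / fact k * exp (- v)))"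
    using z v by (intro suminf_cong)
      (simp add: emeasure_eq_measure law ennreal_mult[symmetric] power_mult_distrib)
  also have "\<dots> = ennreal (exp (z * v) * exp (- v))"
  proof (rule suminf_ennreal_eq)
    have "(\<lambda>k. (z * v) ^ k /\<^sub>R fact k) sums exp (z * v)" by (rule exp_converges)
    from sums_mult2[OF this, of "exp (- v)"]
    show "(\<lambda>k. (z * v) ^ k / fact k * exp (- v)) sums (exp (z * v) * exp (- v))"
      by (simp add: field_simps)
  qed (use z v in auto)
  also have "exp (z * v) * exp (- v) = exp (v * (z - 1))"
    by (simp add: exp_add[symmetric] algebra_simps)
  finally show ?thesis unfolding K_def v_def .
qed

text \<open>
  Independence means that the joint law agrees with the product of the marginals on rectangles, and
  these determine it. The two ranges may be of different types, as they are for the positions of the centers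
  and their appetites.
\<close>

lemma (in prob_space) distr_pair_eq_of_indep_set:
  assumes [measurable]: "X \<in> measurable M S" "Y \<in> measurable M T"
    and indep: "indep_set (sets (vimage_algebra (space M) X S)) (sets (vimage_algebra (space M) Y T))"
  shows "distr M S X \<Otimes>\<^sub>M distr M T Y = distr M (S \<Otimes>\<^sub>M T) (\<lambda>\<omega>. (X \<omega>, Y \<omega>))"
proof (rule pair_measure_eqI)
  show "sigma_finite_measure (distr M S X)" "sigma_finite_measure (distr M T Y)"
    by (auto intro!: prob_space_imp_sigma_finite prob_space_distr)
  show "sets (distr M S X \<Otimes>\<^sub>M distr M T Y) = sets (distr M (S \<Otimes>\<^sub>M T) (\<lambda>\<omega>. (X \<omega>, Y \<omega>)))"
    by (simp cong: sets_pair_measure_cong)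
  fix A B
  assume "A \<in> sets (distr M S X)" "B \<in> sets (distr M T Y)"
  then have [measurable]: "A \<in> sets S" "B \<in> sets T" by auto
  have "prob ((X -` A \<inter> space M) \<inter> (Y -` B \<inter> space M)) = prob (X -` A \<inter> space M) * prob (Y -` B \<inter> space M)"
    by (intro indep_setD[OF indep] in_vimage_algebra) auto
  also have "(X -` A \<inter> space M) \<inter> (Y -` B \<inter> space M) = (\<lambda>\<omega>. (X \<omega>, Y \<omega>)) -` (A \<times> B) \<inter> space M"
    by auto
  finally show "emeasure (distr M S X) A * emeasure (distr M T Y) B =
      emeasure (distr M (S \<Otimes>\<^sub>M T) (\<lambda>\<omega>. (X \<omega>, Y \<omega>))) (A \<times> B)"
    by (simp add: emeasure_distr emeasure_eq_measure ennreal_mult)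
qed

text \<open>
  Conditionally on the positions of the centers, the sum over \<open>B\<close> is a sum of
  \<open>card (\<Theta> \<omega> \<inter> B)\<close> i.i.d. appetites, so its exponential moment is a power of
  that of a single appetite. Since the centers are random, \<open>S\<close> is constructed as a measurable
  function of the enumeration of the centers and of the sequence of appetites, and the conditioning is
  Fubini's theorem for the product law of the two.
\<close>

lemma iid_appetite_sum_laplace:
  fixes \<Theta> :: "'w \<Rightarrow> 'a::euclidean_space set"
  assumes "prob_space M" and iid: "iid_appetites M \<Theta> D app"
    and [measurable]: "B \<in> sets borel" and fin: "AE \<omega> in M. finite (\<Theta> \<omega> \<inter> B)"
  obtains S where "S \<in> borel_measurable M"
    and "AE \<omega> in M. S \<omega> = (\<Sum>\<xi>\<in>\<Theta> \<omega> \<inter> B. app \<omega> \<xi>)"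
    and "\<And>s. (\<integral>\<^sup>+\<omega>. ennreal (exp (s * S \<omega>)) \<partial>M) =
           (\<integral>\<^sup>+\<omega>. (\<integral>\<^sup>+z. ennreal (exp (s * z)) \<partial>D) ^ card (\<Theta> \<omega> \<inter> B) \<partial>M)"
proof -
  interpret prob_space M by fact
  obtain x :: "nat \<Rightarrow> 'w \<Rightarrow> 'a" where
    [measurable]: "\<And>n. x n \<in> borel_measurable M" and
    bij: "AE \<omega> in M. bij_betw (\<lambda>n. x n \<omega>) UNIV (\<Theta> \<omega>)" and
    indep_a: "indep_vars (\<lambda>_. borel) (\<lambda>n \<omega>. app \<omega> (x n \<omega>)) UNIV" and
    law: "\<And>n. distr M borel (\<lambda>\<omega>. app \<omega> (x n \<omega>)) = D" and
    indep_xa: "indep_set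
          (sets (vimage_algebra (space M) (\<lambda>\<omega> n. x n \<omega>) (PiM UNIV (\<lambda>_. borel))))
          (sets (vimage_algebra (space M) (\<lambda>\<omega> n. app \<omega> (x n \<omega>)) (PiM UNIV (\<lambda>_. borel))))"
    using iid unfolding iid_appetites_def by blast
  define a where "a n \<omega> = app \<omega> (x n \<omega>)" for n \<omega>
  note indep_a = indep_a[folded a_def] and law = law[folded a_def] and indep_xa = indep_xa[folded a_def]
  have [measurable]: "a n \<in> borel_measurable M" for n
    using indep_a by (simp add: indep_vars_def)
  let ?P = "PiM UNIV (\<lambda>_::nat. borel) :: (nat \<Rightarrow> 'a) measure"
  let ?Q = "PiM UNIV (\<lambda>_::nat. borel) :: (nat \<Rightarrow> real) measure"
  define Y where "Y \<omega> = (\<lambda>n. x n \<omega>)" for \<omega>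
  define A where "A \<omega> = (\<lambda>n. a n \<omega>)" for \<omega>
  have [measurable]: "Y \<in> measurable M ?P" "A \<in> measurable M ?Q"
    unfolding Y_def A_def by (auto intro!: measurable_PiM_single')
  have joint: "distr M ?P Y \<Otimes>\<^sub>M distr M ?Q A = distr M (?P \<Otimes>\<^sub>M ?Q) (\<lambda>\<omega>. (Y \<omega>, A \<omega>))"
    by (intro distr_pair_eq_of_indep_set)
      (measurable, use indep_xa in \<open>simp add: Y_def[abs_def] A_def[abs_def]\<close>)
  interpret PA: prob_space "distr M ?Q A" by (rule prob_space_distr) simp
  \<comment> \<open>A series is measurable without any condition on its convergence; it is a finite sum as soon as only
    finitely many points lie in \<open>B\<close>, which holds almost surely.\<close>
  define G where "G y b = (\<Sum>k. indicator B (y k) * b k :: real)" for y :: "nat \<Rightarrow> 'a" and b :: "nat \<Rightarrow> real"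
  have G_sum: "G y b = (\<Sum>k | y k \<in> B. b k)" if "finite {k. y k \<in> B}" for y b
    unfolding G_def using that
    by (subst suminf_finite[of "{k. y k \<in> B}"]) (auto simp: indicator_def intro!: sum.cong)
  have G_meas [measurable]: "(\<lambda>(y, b). G y b) \<in> borel_measurable (?P \<Otimes>\<^sub>M ?Q)"
    unfolding G_def by measurable
  define S where "S \<omega> = G (Y \<omega>) (A \<omega>)" for \<omega>
  have S_meas [measurable]: "S \<in> borel_measurable M"
    unfolding S_def by measurable
  have good: "AE \<omega> in M. finite {k. x k \<omega> \<in> B} \<and> card {k. x k \<omega> \<in> B} = card (\<Theta> \<omega> \<inter> B) \<and>
      (\<Sum>k | x k \<omega> \<in> B. a k \<omega>) = (\<Sum>\<xi>\<in>\<Theta> \<omega> \<inter> B. app \<omega> \<xi>)"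
    using bij fin
  proof eventually_elim
    case (elim \<omega>)
    then have b: "bij_betw (\<lambda>k. x k \<omega>) {k. x k \<omega> \<in> B} (\<Theta> \<omega> \<inter> B)"
      unfolding bij_betw_def by (auto intro: inj_on_subset)
    show ?case
      using bij_betw_finite[OF b] bij_betw_same_card[OF b] elim(2) sum.reindex_bij_betw[OF b, of "app \<omega>"]
      by (simp add: a_def)
  qed
  have "AE \<omega> in M. S \<omega> = (\<Sum>\<xi>\<in>\<Theta> \<omega> \<inter> B. app \<omega> \<xi>)"
    using good by eventually_elim (simp add: S_def G_sum Y_def A_def)
  moreover have "(\<integral>\<^sup>+\<omega>. ennreal (exp (s * S \<omega>)) \<partial>M) =
           (\<integral>\<^sup>+\<omega>. (\<integral>\<^sup>+z. ennreal (exp (s * z)) \<partial>D) ^ card (\<Theta> \<omega> \<inter> B) \<partial>M)" for s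
  proof -
    have inner: "(\<integral>\<^sup>+\<omega>'. ennreal (exp (s * G y (A \<omega>'))) \<partial>M) =
        (\<integral>\<^sup>+z. ennreal (exp (s * z)) \<partial>D) ^ card {k. y k \<in> B}"
      if y: "finite {k. y k \<in> B}" for y
    proof -
      have "(\<integral>\<^sup>+\<omega>'. ennreal (exp (s * G y (A \<omega>'))) \<partial>M) =
          (\<integral>\<^sup>+\<omega>'. (\<Prod>k | y k \<in> B. ennreal (exp (s * a k \<omega>'))) \<partial>M)"
        using y by (simp add: G_sum A_def sum_distrib_left exp_sum prod_ennreal)
      also have "\<dots> = (\<Prod>k | y k \<in> B. \<integral>\<^sup>+\<omega>'. ennreal (exp (s * a k \<omega>')) \<partial>M)"
        using y by (intro indep_vars_nn_integral
            indep_vars_compose2[OF indep_vars_subset[OF indep_a]]) auto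
      also have "\<dots> = (\<Prod>k | y k \<in> B. \<integral>\<^sup>+z. ennreal (exp (s * z)) \<partial>D)"
        by (intro prod.cong refl) (subst law[symmetric], subst nn_integral_distr, auto)
      finally show ?thesis by simp
    qed
    have "(\<integral>\<^sup>+\<omega>. ennreal (exp (s * S \<omega>)) \<partial>M) =
        (\<integral>\<^sup>+p. ennreal (exp (s * (case p of (y, b) \<Rightarrow> G y b))) \<partial>distr M (?P \<Otimes>\<^sub>M ?Q) (\<lambda>\<omega>. (Y \<omega>, A \<omega>)))"
      by (subst nn_integral_distr) (auto simp: S_def)
    also have "\<dots> = (\<integral>\<^sup>+y. (\<integral>\<^sup>+b. ennreal (exp (s * G y b)) \<partial>distr M ?Q A) \<partial>distr M ?P Y)"
      unfolding joint[symmetric] by (subst PA.nn_integral_fst[symmetric]) auto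
    also have "\<dots> = (\<integral>\<^sup>+\<omega>. (\<integral>\<^sup>+b. ennreal (exp (s * G (Y \<omega>) b)) \<partial>distr M ?Q A) \<partial>M)"
      by (subst nn_integral_distr) auto
    also have "\<dots> = (\<integral>\<^sup>+\<omega>. (\<integral>\<^sup>+\<omega>'. ennreal (exp (s * G (Y \<omega>) (A \<omega>'))) \<partial>M) \<partial>M)"
      by (intro nn_integral_cong nn_integral_distr) (auto simp: Y_def space_PiM)
    also have "\<dots> = (\<integral>\<^sup>+\<omega>. (\<integral>\<^sup>+z. ennreal (exp (s * z)) \<partial>D) ^ card (\<Theta> \<omega> \<inter> B) \<partial>M)"
      using good by (intro nn_integral_cong_AE, eventually_elim) (simp add: inner Y_def)
    finally show ?thesis .
  qed
  ultimately show thesis using S_meas that by blast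
qed

lemma AE_iid_appetites:
  assumes "prob_space M" and iid: "iid_appetites M \<Theta> D app"
    and P: "{z. P z} \<in> sets borel" "AE z in D. P z"
  shows "AE \<omega> in M. \<forall>\<xi>\<in>\<Theta> \<omega>. P (app \<omega> \<xi>)"
proof -
  interpret prob_space M by fact
  obtain x where bij: "AE \<omega> in M. bij_betw (\<lambda>n. x n \<omega>) (UNIV :: nat set) (\<Theta> \<omega>)"
    and a: "indep_vars (\<lambda>_. borel) (\<lambda>n \<omega>. app \<omega> (x n \<omega>)) UNIV"
    and law: "\<And>n. distr M borel (\<lambda>\<omega>. app \<omega> (x n \<omega>)) = D"
    using iid unfolding iid_appetites_def by blast
  have "AE \<omega> in M. P (app \<omega> (x n \<omega>))" for n
  proof -
    have meas: "(\<lambda>\<omega>. app \<omega> (x n \<omega>)) \<in> borel_measurable M"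
      using a by (simp add: indep_vars_def)
    have "AE z in distr M borel (\<lambda>\<omega>. app \<omega> (x n \<omega>)). P z"
      unfolding law by (rule P(2))
    then show ?thesis using P(1) by (subst (asm) AE_distr_iff[OF meas]) auto
  qed
  then have "AE \<omega> in M. \<forall>n. P (app \<omega> (x n \<omega>))" by (simp add: AE_all_countable)
  with bij show ?thesis
    by eventually_elim (metis bij_betw_imp_surj_on imageE)
qed

text \<open>
  For negative arguments this is a division-free form of
  \<open>exp (- y) \<le> 1 / (1 + y) \<le> 1 - y + y\<^sup>2\<close>, the last step being
  \<open>1 \<le> 1 + y ^ 3\<close>.
\<close>

lemma exp_le_quadratic:
  fixes z :: real
  assumes "z \<le> 1"
  shows "exp z \<le> 1 + z + z\<^sup>2"
proof (cases "0 \<le> z")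
  case True
  then show ?thesis using exp_bound assms by blast
next
  case False
  have "0 \<le> (z + 1 / 2)\<^sup>2" by simp
  then have pos: "0 \<le> 1 + z + z\<^sup>2" by (simp add: power2_eq_square algebra_simps)
  have "z * z\<^sup>2 \<le> 0"
    using False by (intro mult_nonpos_nonneg) auto
  then have "1 \<le> (1 + z + z\<^sup>2) * (1 - z)"
    by (simp add: algebra_simps power2_eq_square)
  also have "\<dots> \<le> (1 + z + z\<^sup>2) * exp (- z)"
    using exp_ge_add_one_self[of "- z"] pos by (intro mult_left_mono) auto
  finally show ?thesis by (simp add: exp_minus field_simps)
qed

text \<open>
  A second-order bound on the moment generating function, for both signs of
  \<open>s\<close>. For \<open>s < 0\<close> and nonnegative \<open>X\<close> the condition on \<open>s * X\<close> is
  automatic, so that two moments suffice; for \<open>s > 0\<close> it bounds \<open>X\<close> from above.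
\<close>

lemma exponential_moment_le_quadratic:
  fixes X :: "'s \<Rightarrow> real"
  assumes "prob_space N" and X: "integrable N X" "integrable N (\<lambda>x. (X x)\<^sup>2)"
    and s: "AE x in N. s * X x \<le> 1"
  shows "0 \<le> 1 + s * (\<integral>x. X x \<partial>N) + s\<^sup>2 * (\<integral>x. (X x)\<^sup>2 \<partial>N)"
    and "(\<integral>\<^sup>+z. ennreal (exp (s * z)) \<partial>distr N borel X)
      \<le> ennreal (1 + s * (\<integral>x. X x \<partial>N) + s\<^sup>2 * (\<integral>x. (X x)\<^sup>2 \<partial>N))"
proof -
  interpret prob_space N by fact
  have [measurable]: "X \<in> borel_measurable N" using X by auto
  let ?q = "\<lambda>x. 1 + s * X x + s\<^sup>2 * (X x)\<^sup>2"
  have q: "exp (s * X x) \<le> ?q x" if "s * X x \<le> 1" for x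
    using exp_le_quadratic[OF that] by (simp add: power_mult_distrib)
  have q0: "AE x in N. 0 \<le> ?q x"
    using s by eventually_elim (use q exp_ge_zero order_trans in blast)
  have mean: "(\<integral>x. ?q x \<partial>N) = 1 + s * (\<integral>x. X x \<partial>N) + s\<^sup>2 * (\<integral>x. (X x)\<^sup>2 \<partial>N)"
    using X by (simp add: prob_space)
  show "0 \<le> 1 + s * (\<integral>x. X x \<partial>N) + s\<^sup>2 * (\<integral>x. (X x)\<^sup>2 \<partial>N)"
    unfolding mean[symmetric] using q0 by (rule integral_nonneg_AE)
  have "(\<integral>\<^sup>+z. ennreal (exp (s * z)) \<partial>distr N borel X) = (\<integral>\<^sup>+x. ennreal (exp (s * X x)) \<partial>N)"
    by (rule nn_integral_distr) auto
  also have "\<dots> \<le> (\<integral>\<^sup>+x. ennreal (?q x) \<partial>N)"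
    using s by (intro nn_integral_mono_AE) (auto elim!: eventually_mono intro!: ennreal_leI q)
  also have "\<dots> = ennreal (\<integral>x. ?q x \<partial>N)"
    using X q0 by (intro nn_integral_eq_integral) auto
  finally show "(\<integral>\<^sup>+z. ennreal (exp (s * z)) \<partial>distr N borel X)
      \<le> ennreal (1 + s * (\<integral>x. X x \<partial>N) + s\<^sup>2 * (\<integral>x. (X x)\<^sup>2 \<partial>N))"
    unfolding mean .
qed

section \<open>Deviations of sums of appetites\<close>

text \<open>
  The Chernoff bound for the sum of the appetites in \<open>B\<close>. With \<open>s > 0\<close> it controls
  the upper tail, with \<open>s < 0\<close> the lower one. The sandwich for \<open>\<Theta>\<close> covers the
  Poisson process and its Palm version at once: the possible extra center multiplies the exponential moment
  by at most \<open>max 1 b\<close>. The event is enclosed in a measurable set \<open>E\<close>, because the sum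
  itself is only almost surely equal to a measurable function.
\<close>

lemma poisson_appetite_sum_tail:
  fixes \<Xi> :: "'w \<Rightarrow> 'a::euclidean_space set"
  assumes pp: "poisson_process M lam \<Xi>" and lam: "0 \<le> lam" and iid: "iid_appetites M \<Theta> D app"
    and \<Theta>: "\<And>\<omega>. \<Xi> \<omega> \<subseteq> \<Theta> \<omega>" "\<And>\<omega>. \<Theta> \<omega> \<subseteq> insert p (\<Xi> \<omega>)"
    and B: "B \<in> sets borel" "bounded B"
    and b: "0 \<le> b" "(\<integral>\<^sup>+z. ennreal (exp (s * z)) \<partial>D) \<le> ennreal b"
  shows "\<exists>E\<in>sets M. (AE \<omega> in M. u \<le> s * (\<Sum>\<xi>\<in>\<Theta> \<omega> \<inter> B. app \<omega> \<xi>) \<longrightarrow> \<omega> \<in> E) \<and>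
           measure M E \<le> max 1 b * exp (lam * measure lborel B * (b - 1) - u)"
proof -
  interpret prob_space M using pp by (simp add: poisson_process_def)
  have fin: "AE \<omega> in M. finite (\<Xi> \<omega> \<inter> B)"
    using pp B unfolding poisson_process_def by (auto elim: eventually_mono)
  have count [measurable]: "(\<lambda>\<omega>. card (\<Xi> \<omega> \<inter> B)) \<in> measurable M (count_space UNIV)"
    using pp B unfolding poisson_process_def by blast
  have either: "\<Theta> \<omega> \<inter> B = \<Xi> \<omega> \<inter> B \<or> \<Theta> \<omega> \<inter> B = insert p (\<Xi> \<omega> \<inter> B)" for \<omega>
    using \<Theta>[of \<omega>] by blast
  have fin\<Theta>: "AE \<omega> in M. finite (\<Theta> \<omega> \<inter> B)"
    using fin by eventually_elim (metis either finite_insert)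
  obtain S where [measurable]: "S \<in> borel_measurable M"
    and S: "AE \<omega> in M. S \<omega> = (\<Sum>\<xi>\<in>\<Theta> \<omega> \<inter> B. app \<omega> \<xi>)"
    and laplace: "\<And>s. (\<integral>\<^sup>+\<omega>. ennreal (exp (s * S \<omega>)) \<partial>M) =
           (\<integral>\<^sup>+\<omega>. (\<integral>\<^sup>+z. ennreal (exp (s * z)) \<partial>D) ^ card (\<Theta> \<omega> \<inter> B) \<partial>M)"
    using iid_appetite_sum_laplace[OF prob_space_axioms iid B(1) fin\<Theta>] by blast
  define E where "E = {\<omega> \<in> space M. u \<le> s * S \<omega>}"
  have E [measurable]: "E \<in> sets M" unfolding E_def by measurable
  have "AE \<omega> in M. u \<le> s * (\<Sum>\<xi>\<in>\<Theta> \<omega> \<inter> B. app \<omega> \<xi>) \<longrightarrow> \<omega> \<in> E"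
    using S AE_space by eventually_elim (auto simp: E_def)
  moreover have "measure M E \<le> max 1 b * exp (lam * measure lborel B * (b - 1) - u)"
  proof -
    have pow: "ennreal b ^ card (\<Theta> \<omega> \<inter> B) \<le> ennreal (max 1 b) * ennreal b ^ card (\<Xi> \<omega> \<inter> B)"
      if "finite (\<Xi> \<omega> \<inter> B)" for \<omega>
    proof -
      have "card (\<Theta> \<omega> \<inter> B) = card (\<Xi> \<omega> \<inter> B) \<or> card (\<Theta> \<omega> \<inter> B) = Suc (card (\<Xi> \<omega> \<inter> B))"
        using either[of \<omega>] that by (auto simp: card_insert_if split: if_splits)
      then have "b ^ card (\<Theta> \<omega> \<inter> B) \<le> max 1 b * b ^ card (\<Xi> \<omega> \<inter> B)"
        using b(1) mult_right_mono[of 1 "max 1 b" "b ^ card (\<Xi> \<omega> \<inter> B)"]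
          mult_right_mono[of b "max 1 b" "b ^ card (\<Xi> \<omega> \<inter> B)"] by auto
      then show ?thesis
        using b(1) by (simp add: ennreal_power ennreal_mult[symmetric] ennreal_leI)
    qed
    have "ennreal (measure M E) = (\<integral>\<^sup>+\<omega>. indicator E \<omega> \<partial>M)"
      by (simp add: emeasure_eq_measure)
    also have "\<dots> \<le> (\<integral>\<^sup>+\<omega>. ennreal (exp (- u)) * ennreal (exp (s * S \<omega>)) \<partial>M)"
      by (intro nn_integral_mono)
        (auto simp: E_def indicator_def ennreal_mult[symmetric] exp_add[symmetric] simp flip: ennreal_1 intro!: ennreal_leI)
    also have "\<dots> = ennreal (exp (- u)) * (\<integral>\<^sup>+\<omega>. (\<integral>\<^sup>+z. ennreal (exp (s * z)) \<partial>D) ^ card (\<Theta> \<omega> \<inter> B) \<partial>M)"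
      by (simp add: nn_integral_cmult laplace)
    also have "\<dots> \<le> ennreal (exp (- u)) * (\<integral>\<^sup>+\<omega>. ennreal (max 1 b) * ennreal b ^ card (\<Xi> \<omega> \<inter> B) \<partial>M)"
    proof (intro mult_left_mono nn_integral_mono_AE)
      show "AE \<omega> in M. (\<integral>\<^sup>+z. ennreal (exp (s * z)) \<partial>D) ^ card (\<Theta> \<omega> \<inter> B)
          \<le> ennreal (max 1 b) * ennreal b ^ card (\<Xi> \<omega> \<inter> B)"
        using fin
        by eventually_elim (rule order_trans[OF power_mono[OF b(2) zero_le] pow])
    qed simp
    also have "\<dots> = ennreal (exp (- u)) * (ennreal (max 1 b) * ennreal (exp (lam * measure lborel B * (b - 1))))"
      using expectation_power_poisson_count[OF pp B b(1) lam] by (subst nn_integral_cmult) auto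
    also have "\<dots> = ennreal (max 1 b * exp (lam * measure lborel B * (b - 1) - u))"
      by (simp add: ennreal_mult[symmetric] mult.left_commute exp_diff exp_minus divide_inverse)
    finally show ?thesis by (simp add: ennreal_le_iff)
  qed
  ultimately show ?thesis using E by blast
qed

text \<open>
  If \<open>n < f \<omega> \<le> n + 1\<close>, then \<open>\<omega>\<close> lies in \<open>E n\<close> and
  \<open>exp (c * f \<omega> ^ d)\<close> is at most \<open>exp (c * (n + 1) ^ d)\<close>; for small \<open>c\<close> the
  probability of \<open>E n\<close> makes the sum of these values over \<open>n\<close> integrable. As
  \<open>f\<close> may be nonmeasurable, the upper expectation is bounded through the measurable series \<open>g\<close>
  of these terms, which diverges where \<open>f\<close> is infinite.
\<close>

lemma exponential_moment_of_exponential_tail: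
  fixes f :: "'w \<Rightarrow> ennreal" and d :: nat
  assumes "prob_space M" and d: "0 < d" and \<kappa>: "0 < \<kappa>"
    and E [measurable]: "\<And>n. E n \<in> sets M"
    and tail: "\<And>n. measure M (E n) \<le> C * exp (- \<kappa> * real n ^ d)"
    and f: "AE \<omega> in M. \<forall>n. of_nat n < f \<omega> \<longrightarrow> \<omega> \<in> E n"
  obtains c where "0 < c"
    and "\<And>h K. (\<And>r. 0 \<le> r \<Longrightarrow> h r \<le> K * exp (c * r ^ d)) \<Longrightarrow>
           upper_expectation M (\<lambda>\<omega>. extend_top h (f \<omega>)) < \<infinity>"
proof -
  interpret prob_space M by fact
  \<comment> \<open>This makes \<open>c * (n + 1) ^ d \<le> c + \<kappa> / 2 * n ^ d\<close>, half of the available decay.\<close>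
  define c where "c = \<kappa> / 2 ^ Suc d"
  have c: "0 < c" using \<kappa> by (simp add: c_def)
  define a where "a n = exp (c * real (Suc n) ^ d)" for n
  have a1: "1 \<le> a n" for n using c by (simp add: a_def)
  have C: "0 \<le> C"
    using order_trans[OF measure_nonneg tail[of 0]] d by (simp add: zero_le_mult_iff power_0_left)
  have "a n * exp (- \<kappa> * real n ^ d) \<le> exp c * exp (- \<kappa> / 2) ^ n" for n
  proof -
    have "real (Suc n) ^ d \<le> 1 + 2 ^ d * real n ^ d"
    proof (cases n)
      case (Suc m)
      have "real (Suc n) ^ d \<le> (2 * real n) ^ d"
        using Suc by (intro power_mono) auto
      then show ?thesis by (simp add: power_mult_distrib)
    qed auto
    then have "c * real (Suc n) ^ d \<le> c * (1 + 2 ^ d * real n ^ d)"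
      using c by (intro mult_left_mono) auto
    also have "\<dots> = c + \<kappa> / 2 * real n ^ d"
      by (simp add: c_def field_simps)
    finally have "c * real (Suc n) ^ d - \<kappa> * real n ^ d \<le> c - \<kappa> / 2 * real n ^ d"
      by simp
    also have "\<dots> \<le> c - \<kappa> / 2 * real n"
      using \<kappa> d self_le_power[of "real n" d] by (cases n) auto
    finally have "c * real (Suc n) ^ d + (- \<kappa> * real n ^ d) \<le> c + real n * (- \<kappa> / 2)"
      by (simp add: mult.commute)
    then have "exp (c * real (Suc n) ^ d + (- \<kappa> * real n ^ d)) \<le> exp (c + real n * (- \<kappa> / 2))"
      by (simp only: exp_le_cancel_iff)
    then show ?thesis
      unfolding a_def by (simp only: exp_add exp_of_nat_mult)
  qed
  then have "C * (a n * exp (- \<kappa> * real n ^ d)) \<le> C * (exp c * exp (- \<kappa> / 2) ^ n)" for n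
    using C by (rule mult_left_mono)
  moreover have "a n * measure M (E n) \<le> a n * (C * exp (- \<kappa> * real n ^ d))" for n
    using tail a1[of n] by (intro mult_left_mono) auto
  ultimately have summand: "a n * measure M (E n) \<le> C * exp c * exp (- \<kappa> / 2) ^ n" for n
    by (metis (no_types, opaque_lifting) mult.assoc mult.left_commute order_trans)
  \<comment> \<open>The summand 1 accounts for \<open>f \<omega> = 0\<close>.\<close>
  define g where "g \<omega> = 1 + (\<Sum>n. ennreal (a n) * indicator (E n) \<omega>)" for \<omega>
  have g_meas [measurable]: "g \<in> borel_measurable M"
    unfolding g_def by measurable
  have a0: "0 \<le> a n" for n using a1[of n] by simp
  have "(\<integral>\<^sup>+\<omega>. g \<omega> \<partial>M) = 1 + (\<integral>\<^sup>+\<omega>. (\<Sum>n. ennreal (a n) * indicator (E n) \<omega>) \<partial>M)"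
    unfolding g_def by (subst nn_integral_add) (auto simp: emeasure_space_1)
  also have "\<dots> = 1 + (\<Sum>n. ennreal (a n * measure M (E n)))"
    using a0 by (simp add: nn_integral_suminf nn_integral_cmult emeasure_eq_measure ennreal_mult)
  also have "\<dots> \<le> 1 + (\<Sum>n. ennreal (C * exp c * exp (- \<kappa> / 2) ^ n))"
    using summand by (intro add_left_mono suminf_le ennreal_leI) auto
  also have "\<dots> < \<infinity>"
  proof -
    have "summable (\<lambda>n. C * exp c * exp (- \<kappa> / 2) ^ n)"
      using \<kappa> by (intro summable_mult summable_geometric) auto
    then have "(\<Sum>n. ennreal (C * exp c * exp (- \<kappa> / 2) ^ n)) \<noteq> \<infinity>"
      using C by (subst suminf_ennreal2) auto
    then show ?thesis by (simp add: less_top)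
  qed
  finally have g_fin: "(\<integral>\<^sup>+\<omega>. g \<omega> \<partial>M) < \<infinity>" .
  have "upper_expectation M (\<lambda>\<omega>. extend_top h (f \<omega>)) < \<infinity>"
    if h: "\<And>r. 0 \<le> r \<Longrightarrow> h r \<le> K * exp (c * r ^ d)" for h K
  proof -
    have "AE \<omega> in M. extend_top h (f \<omega>) \<le> ennreal (max 1 K) * g \<omega>"
      using f
    proof eventually_elim
      case (elim \<omega>)
      show ?case
      proof (cases "f \<omega>" rule: ennreal_cases)
        case top
        then have "\<omega> \<in> E n" for n using elim by (auto simp: of_nat_less_top)
        then have "of_nat N \<le> g \<omega>" for N
        proof -
          have "of_nat N = (\<Sum>n<N. 1 :: ennreal)" by simp
          also have "\<dots> \<le> (\<Sum>n<N. ennreal (a n) * indicator (E n) \<omega>)"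
            using \<open>\<And>n. \<omega> \<in> E n\<close> a1 by (intro sum_mono) auto
          also have "\<dots> \<le> (\<Sum>n. ennreal (a n) * indicator (E n) \<omega>)"
            by (intro sum_le_suminf) auto
          finally show ?thesis unfolding g_def by (simp add: add_increasing)
        qed
        then have "g \<omega> = \<infinity>"
          using ennreal_Ex_less_of_nat[of "g \<omega>"] by (auto simp: less_top[symmetric] not_le[symmetric] top_unique)
        then show ?thesis by (simp add: ennreal_mult_eq_top_iff ennreal_mult_top)
      next
        case (real r)
        have "ennreal (h r) \<le> ennreal (max 1 K) * g \<omega>"
        proof (cases "r = 0")
          case True
          have "h r \<le> max 1 K" using h[of 0] d True by (simp add: power_0_left)
          then have "ennreal (h r) \<le> ennreal (max 1 K) * 1" by (simp add: ennreal_leI)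
          also have "\<dots> \<le> ennreal (max 1 K) * g \<omega>"
            unfolding g_def by (intro mult_left_mono) auto
          finally show ?thesis .
        next
          case False
          define n where "n = nat (\<lceil>r\<rceil> - 1)"
          have n: "real n < r" "r \<le> real (Suc n)"
            using False real unfolding n_def by linarith+
          then have "\<omega> \<in> E n"
            using elim real by (simp add: ennreal_of_nat_eq_real_of_nat ennreal_less_iff)
          have "h r \<le> max 1 K * exp (c * r ^ d)"
            using h[of r] real by (smt (verit) exp_ge_zero mult_right_mono)
          also have "\<dots> \<le> max 1 K * a n"
            unfolding a_def using n c real by (intro mult_left_mono) (auto intro!: power_mono)
          finally have "ennreal (h r) \<le> ennreal (max 1 K) * ennreal (a n)"
            using a1[of n] by (simp add: ennreal_mult[symmetric] ennreal_leI)
          also have "ennreal (a n) = (\<Sum>k\<in>{n}. ennreal (a k) * indicator (E k) \<omega>)"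
            using \<open>\<omega> \<in> E n\<close> by simp
          also have "\<dots> \<le> (\<Sum>k. ennreal (a k) * indicator (E k) \<omega>)"
            by (intro sum_le_suminf) auto
          also have "\<dots> \<le> g \<omega>" unfolding g_def by simp
          finally show ?thesis by (simp add: mult_left_mono)
        qed
        then show ?thesis using real by (simp add: extend_top_def)
      qed
    qed
    then have "upper_expectation M (\<lambda>\<omega>. extend_top h (f \<omega>)) \<le> (\<integral>\<^sup>+\<omega>. ennreal (max 1 K) * g \<omega> \<partial>M)"
      unfolding upper_expectation_def by (intro INF_lower) auto
    also have "\<dots> = ennreal (max 1 K) * (\<integral>\<^sup>+\<omega>. g \<omega> \<partial>M)"
      by (rule nn_integral_cmult) simp
    also have "\<dots> < \<infinity>"
      using g_fin by (simp add: ennreal_mult_less_top)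
    finally show ?thesis .
  qed
  with c show thesis using that by blast
qed

text \<open>
  The meeting point of geometry and probability: if \<open>f > n\<close> forces the appetites in the ball of
  radius \<open>\<rho> * n\<close> to deviate by \<open>u\<close> per unit of \<open>n ^ DIM('a)\<close>, and \<open>u\<close> exceeds the
  growth rate of the logarithm of their exponential moment, then \<open>f > n\<close> has probability of order
  \<open>exp (- \<kappa> * n ^ DIM('a))\<close>.
\<close>

lemma moment_of_appetite_sum_deviation:
  fixes \<Xi> :: "'w \<Rightarrow> 'a::euclidean_space set" and f :: "'w \<Rightarrow> ennreal"
  assumes pp: "poisson_process M lam \<Xi>" and lam: "0 \<le> lam"
    and iid: "iid_appetites M \<Theta> D app"
    and \<Theta>: "\<And>\<omega>. \<Xi> \<omega> \<subseteq> \<Theta> \<omega>" "\<And>\<omega>. \<Theta> \<omega> \<subseteq> insert p (\<Xi> \<omega>)"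
    and b: "0 \<le> b" "(\<integral>\<^sup>+z. ennreal (exp (s * z)) \<partial>D) \<le> ennreal b"
    and \<rho>: "0 \<le> \<rho>"
    and rate: "lam * measure lborel (cball (0::'a) \<rho>) * (b - 1) < u"
    and f: "AE \<omega> in M. \<forall>n. of_nat n < f \<omega> \<longrightarrow>
              u * real n ^ DIM('a) \<le> s * (\<Sum>\<xi>\<in>\<Theta> \<omega> \<inter> cball 0 (\<rho> * real n). app \<omega> \<xi>)"
  obtains c where "0 < c"
    and "\<And>h K. (\<And>r. 0 \<le> r \<Longrightarrow> h r \<le> K * exp (c * r ^ DIM('a))) \<Longrightarrow>
           upper_expectation M (\<lambda>\<omega>. extend_top h (f \<omega>)) < \<infinity>"
proof -
  interpret prob_space M using pp by (simp add: poisson_process_def)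
  define V where "V = measure lborel (cball (0::'a) \<rho>)"
  define \<kappa> where "\<kappa> = u - lam * V * (b - 1)"
  have \<kappa>: "0 < \<kappa>" using rate by (simp add: \<kappa>_def V_def)
  have vol: "measure lborel (cball (0::'a) (\<rho> * real n)) = V * real n ^ DIM('a)" for n
    using \<rho> by (simp add: V_def content_cball power_mult_distrib)
  have "\<forall>n. \<exists>E\<in>sets M.
      (AE \<omega> in M. u * real n ^ DIM('a) \<le> s * (\<Sum>\<xi>\<in>\<Theta> \<omega> \<inter> cball 0 (\<rho> * real n). app \<omega> \<xi>) \<longrightarrow> \<omega> \<in> E) \<and>
      measure M E \<le> max 1 b * exp (- \<kappa> * real n ^ DIM('a))"
  proof
    fix n
    have "lam * measure lborel (cball (0::'a) (\<rho> * real n)) * (b - 1) - u * real n ^ DIM('a)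
        = - \<kappa> * real n ^ DIM('a)"
      by (simp add: vol \<kappa>_def algebra_simps)
    then show "\<exists>E\<in>sets M.
      (AE \<omega> in M. u * real n ^ DIM('a) \<le> s * (\<Sum>\<xi>\<in>\<Theta> \<omega> \<inter> cball 0 (\<rho> * real n). app \<omega> \<xi>) \<longrightarrow> \<omega> \<in> E) \<and>
      measure M E \<le> max 1 b * exp (- \<kappa> * real n ^ DIM('a))"
      using poisson_appetite_sum_tail[OF pp lam iid \<Theta> _ _ b,
          of "cball 0 (\<rho> * real n)" "u * real n ^ DIM('a)"] by simp
  qed
  from choice[OF this[unfolded Bex_def]] obtain E where
    E: "\<And>n. E n \<in> sets M" "\<And>n. measure M (E n) \<le> max 1 b * exp (- \<kappa> * real n ^ DIM('a))"
    and AE_E: "\<And>n. AE \<omega> in M. u * real n ^ DIM('a) \<le>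
        s * (\<Sum>\<xi>\<in>\<Theta> \<omega> \<inter> cball 0 (\<rho> * real n). app \<omega> \<xi>) \<longrightarrow> \<omega> \<in> E n"
    by blast
  have "AE \<omega> in M. \<forall>n. u * real n ^ DIM('a) \<le>
        s * (\<Sum>\<xi>\<in>\<Theta> \<omega> \<inter> cball 0 (\<rho> * real n). app \<omega> \<xi>) \<longrightarrow> \<omega> \<in> E n"
    using AE_E by (simp add: AE_all_countable)
  with f have "AE \<omega> in M. \<forall>n. of_nat n < f \<omega> \<longrightarrow> \<omega> \<in> E n"
    by eventually_elim blast
  from exponential_moment_of_exponential_tail[OF prob_space_axioms DIM_positive \<kappa> E this]
  show thesis using that by blast
qed

section \<open>The supercritical and the subcritical model\<close>

lemma powr_le_one_plus_power:
  fixes r p :: real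
  assumes "0 \<le> r" "0 \<le> p" "p \<le> real d"
  shows "r powr p \<le> 1 + r ^ d"
proof (cases "r \<le> 1")
  case True
  then have "r powr p \<le> 1 powr p" using assms by (intro powr_mono2) auto
  then show ?thesis using assms by (simp add: add_increasing2)
next
  case False
  then have "r powr p \<le> r powr real d" using assms by (intro powr_mono) auto
  then show ?thesis using False by (simp add: powr_realpow)
qed

text \<open>
  An origin farther than \<open>n\<close> from its center, or unclaimed, forces the appetites in the ball of radius
  \<open>n\<close>, whose expected sum is \<open>\<mu>\<close> times its volume, to sum to at most
  \<open>2 ^ DIM('a) < \<mu>\<close> times its volume: an atypically low value, hence a negative Chernoff parameter.
\<close>

lemma supercritical_site_distance_moment:
  fixes N :: "'s measure" and \<alpha> :: "'s \<Rightarrow> real"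
    and P :: "'w measure" and \<Xi> :: "'w \<Rightarrow> 'a::euclidean_space set"
  assumes "prob_space N" and nonneg: "AE s in N. 0 \<le> \<alpha> s"
    and int: "integrable N \<alpha>" "integrable N (\<lambda>s. (\<alpha> s)\<^sup>2)"
    and super: "2 ^ DIM('a) < (\<integral>s. \<alpha> s \<partial>N)"
    and model: "stable_model P 1 (distr N borel \<alpha>) \<Xi> app \<psi>"
    and p: "0 \<le> p" "p \<le> real DIM('a)"
  shows "upper_expectation P (\<lambda>\<omega>. extend_top (\<lambda>r. r powr p) (alloc_dist (\<psi> \<omega>) 0)) < \<infinity>"
proof -
  let ?d = "DIM('a)"
  interpret N: prob_space N by fact
  have pp: "poisson_process P 1 \<Xi>" and iid: "iid_appetites P \<Xi> (distr N borel \<alpha>) app"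
    and st: "AE \<omega> in P. stable_allocation (\<Xi> \<omega>) (app \<omega>) (\<psi> \<omega>)"
    using model by (auto simp: stable_model_def)
  have fin: "AE \<omega> in P. \<forall>B. bounded B \<longrightarrow> finite (\<Xi> \<omega> \<inter> B)"
    using pp by (simp add: poisson_process_def)
  define \<beta> where "\<beta> = unit_ball_vol (real ?d)"
  have \<beta>: "0 < \<beta>" by (simp add: \<beta>_def)
  define \<mu> q where "\<mu> = (\<integral>s. \<alpha> s \<partial>N)" and "q = (\<integral>s. (\<alpha> s)\<^sup>2 \<partial>N)"
  \<comment> \<open>Small enough for the quadratic term \<open>t\<^sup>2 * q\<close> not to eat up the linear gain
    \<open>t * (\<mu> - 2 ^ DIM('a))\<close>; the denominator \<open>q + 1\<close> cannot vanish.\<close>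
  define t where "t = (\<mu> - 2 ^ ?d) / (q + 1)"
  have q: "0 \<le> q" by (simp add: q_def)
  have t: "0 < t" and tq: "t * q < \<mu> - 2 ^ ?d"
  proof -
    show t: "0 < t" using super q by (simp add: t_def \<mu>_def)
    have "t * q < t * (q + 1)" using t by simp
    also have "\<dots> = \<mu> - 2 ^ ?d" using q by (simp add: t_def)
    finally show "t * q < \<mu> - 2 ^ ?d" .
  qed
  have sgn: "AE s in N. - t * \<alpha> s \<le> 1"
    using nonneg by eventually_elim (use t in \<open>auto intro: order_trans[of _ 0]\<close>)
  note b = exponential_moment_le_quadratic[OF \<open>prob_space N\<close> int sgn, folded \<mu>_def q_def]
  have rate: "1 * measure lborel (cball (0::'a) 1) * (1 + - t * \<mu> + (- t)\<^sup>2 * q - 1)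
      < - t * (\<beta> * 2 ^ ?d)"
  proof -
    have "\<beta> * t * (t * q) < \<beta> * t * (\<mu> - 2 ^ ?d)"
      using \<beta> t tq by (intro mult_strict_left_mono) auto
    then show ?thesis
      by (simp add: content_cball \<beta>_def[symmetric] algebra_simps power2_eq_square)
  qed
  have "AE \<omega> in P. \<forall>n. of_nat n < alloc_dist (\<psi> \<omega>) 0 \<longrightarrow>
      - t * (\<beta> * 2 ^ ?d) * real n ^ ?d \<le> - t * (\<Sum>\<xi>\<in>\<Xi> \<omega> \<inter> cball 0 (1 * real n). app \<omega> \<xi>)"
    using st fin
  proof (eventually_elim, intro allI impI)
    fix \<omega> n
    assume "stable_allocation (\<Xi> \<omega>) (app \<omega>) (\<psi> \<omega>)" "\<forall>B. bounded B \<longrightarrow> finite (\<Xi> \<omega> \<inter> B)"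
      and "of_nat n < alloc_dist (\<psi> \<omega>) 0"
    then have "(\<Sum>\<xi>\<in>\<Xi> \<omega> \<inter> cball 0 (real n). app \<omega> \<xi>) \<le> measure lborel (cball (0::'a) (2 * real n))"
      by (intro far_site_imp_appetites_le_volume) (auto simp: ennreal_of_nat_eq_real_of_nat)
    also have "\<dots> = \<beta> * 2 ^ ?d * real n ^ ?d"
      by (simp add: content_cball \<beta>_def power_mult_distrib)
    finally show "- t * (\<beta> * 2 ^ ?d) * real n ^ ?d
        \<le> - t * (\<Sum>\<xi>\<in>\<Xi> \<omega> \<inter> cball 0 (1 * real n). app \<omega> \<xi>)"
      using mult_left_mono[of _ _ t] t by (simp add: mult.assoc)
  qed
  from moment_of_appetite_sum_deviation[OF pp zero_le_one iid order_refl subset_insertI b zero_le_one rate this]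
  obtain c where c: "0 < c" and moment: "\<And>h K. (\<And>r. 0 \<le> r \<Longrightarrow> h r \<le> K * exp (c * r ^ ?d)) \<Longrightarrow>
      upper_expectation P (\<lambda>\<omega>. extend_top h (alloc_dist (\<psi> \<omega>) 0)) < \<infinity>"
    by blast
  have "r powr p \<le> (1 + 1 / c) * exp (c * r ^ ?d)" if "0 \<le> r" for r
  proof -
    have "r powr p \<le> 1 + c * r ^ ?d / c"
      using powr_le_one_plus_power[OF that p] c by simp
    also have "\<dots> \<le> exp (c * r ^ ?d) + exp (c * r ^ ?d) / c"
    proof (intro add_mono divide_right_mono)
      show "1 \<le> exp (c * r ^ ?d)" using c that by simp
      show "c * r ^ ?d \<le> exp (c * r ^ ?d)"
        using exp_ge_add_one_self[of "c * r ^ ?d"] by linarith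
    qed (use c in simp)
    finally show ?thesis by (simp add: algebra_simps)
  qed
  then show ?thesis by (rule moment)
qed

text \<open>
  A territory radius above \<open>n\<close> forces the appetites in the ball of radius \<open>2 * n\<close> to
  sum to at least the volume of the ball of radius \<open>n\<close>, whereas their expected sum, apart from
  the appetite of the origin, is only \<open>\<mu> * 2 ^ DIM('a) < 1\<close> times that volume: an atypically
  high value, hence a positive Chernoff parameter.
\<close>

lemma subcritical_territory_radius_moment:
  fixes N :: "'s measure" and \<alpha> :: "'s \<Rightarrow> real"
    and P :: "'w measure" and \<Xi> :: "'w \<Rightarrow> 'a::euclidean_space set"
  assumes "prob_space N" and [measurable]: "\<alpha> \<in> borel_measurable N"
    and nonneg: "AE s in N. 0 \<le> \<alpha> s" and bounded: "AE s in N. \<alpha> s \<le> A"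
    and sub: "(\<integral>s. \<alpha> s \<partial>N) < 1 / 2 ^ DIM('a)"
    and model: "palm_stable_model P 1 (distr N borel \<alpha>) \<Xi> app \<psi>"
    and p: "0 \<le> p" "p \<le> real DIM('a)"
  shows "\<exists>c>0. upper_expectation P
           (\<lambda>\<omega>. extend_top (\<lambda>r. exp (c * r powr p)) (territory_radius (\<psi> \<omega>) 0)) < \<infinity>"
proof -
  let ?d = "DIM('a)"
  interpret N: prob_space N by fact
  have pp: "poisson_process P 1 \<Xi>"
    and iid: "iid_appetites P (\<lambda>\<omega>. insert 0 (\<Xi> \<omega>)) (distr N borel \<alpha>) app"
    and st: "AE \<omega> in P. stable_allocation (insert 0 (\<Xi> \<omega>)) (app \<omega>) (\<psi> \<omega>)"
    using model by (auto simp: palm_stable_model_def)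
  have "prob_space P" and fin: "AE \<omega> in P. \<forall>B. bounded B \<longrightarrow> finite (\<Xi> \<omega> \<inter> B)"
    using pp by (auto simp: poisson_process_def)
  have app: "AE \<omega> in P. \<forall>\<xi>\<in>insert 0 (\<Xi> \<omega>). 0 \<le> app \<omega> \<xi>"
    using \<open>prob_space P\<close> iid by (rule AE_iid_appetites) (use nonneg in \<open>auto simp: AE_distr_iff\<close>)
  have int: "integrable N \<alpha>" "integrable N (\<lambda>s. (\<alpha> s)\<^sup>2)"
  proof -
    have 1: "AE s in N. norm (\<alpha> s) \<le> A" and 2: "AE s in N. norm ((\<alpha> s)\<^sup>2) \<le> A\<^sup>2"
      using nonneg bounded by (eventually_elim; auto intro: power_mono)+
    show "integrable N \<alpha>" by (rule N.integrable_const_bound[OF 1]) simp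
    show "integrable N (\<lambda>s. (\<alpha> s)\<^sup>2)" by (rule N.integrable_const_bound[OF 2]) simp
  qed
  define \<beta> where "\<beta> = unit_ball_vol (real ?d)"
  have \<beta>: "0 < \<beta>" by (simp add: \<beta>_def)
  define \<mu> q where "\<mu> = (\<integral>s. \<alpha> s \<partial>N)" and "q = (\<integral>s. (\<alpha> s)\<^sup>2 \<partial>N)"
  \<comment> \<open>The first bound gives \<open>t * \<alpha> s \<le> 1\<close>, the second one keeps the quadratic term below the
    linear gain.\<close>
  define t where "t = min (1 / max 1 A) ((1 / 2 ^ ?d - \<mu>) / (q + 1))"
  have q: "0 \<le> q" by (simp add: q_def)
  have t: "0 < t" and tq: "t * q < 1 / 2 ^ ?d - \<mu>" and tA: "t * max 1 A \<le> 1"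
  proof -
    show t: "0 < t" using sub q by (simp add: t_def \<mu>_def)
    have "t * q < t * (q + 1)" using t by simp
    also have "\<dots> \<le> (1 / 2 ^ ?d - \<mu>) / (q + 1) * (q + 1)"
      using q by (intro mult_right_mono) (auto simp: t_def)
    also have "\<dots> = 1 / 2 ^ ?d - \<mu>" using q by simp
    finally show "t * q < 1 / 2 ^ ?d - \<mu>" .
    have "t * max 1 A \<le> 1 / max 1 A * max 1 A"
      by (intro mult_right_mono) (auto simp: t_def)
    then show "t * max 1 A \<le> 1" by (simp split: if_splits)
  qed
  have small: "AE s in N. t * \<alpha> s \<le> 1"
    using bounded
  proof eventually_elim
    case (elim s)
    then have "t * \<alpha> s \<le> t * max 1 A" using t by (intro mult_left_mono) auto
    then show ?case using tA by simp
  qed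
  note b = exponential_moment_le_quadratic[OF \<open>prob_space N\<close> int small, folded \<mu>_def q_def]
  have rate: "1 * measure lborel (cball (0::'a) 2) * (1 + t * \<mu> + t\<^sup>2 * q - 1) < t * \<beta>"
  proof -
    have "\<beta> * t * 2 ^ ?d * (t * q) < \<beta> * t * 2 ^ ?d * (1 / 2 ^ ?d - \<mu>)"
      using \<beta> t tq by (intro mult_strict_left_mono) auto
    then show ?thesis
      by (simp add: content_cball \<beta>_def[symmetric] algebra_simps power2_eq_square)
  qed
  have "AE \<omega> in P. \<forall>n. of_nat n < territory_radius (\<psi> \<omega>) 0 \<longrightarrow>
      t * \<beta> * real n ^ ?d \<le> t * (\<Sum>\<xi>\<in>insert 0 (\<Xi> \<omega>) \<inter> cball 0 (2 * real n). app \<omega> \<xi>)"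
    using st fin app
  proof (eventually_elim, intro allI impI)
    fix \<omega> n
    assume "stable_allocation (insert 0 (\<Xi> \<omega>)) (app \<omega>) (\<psi> \<omega>)"
      and fin: "\<forall>B. bounded B \<longrightarrow> finite (\<Xi> \<omega> \<inter> B)"
      and "\<forall>\<xi>\<in>insert 0 (\<Xi> \<omega>). 0 \<le> app \<omega> \<xi>"
      and "of_nat n < territory_radius (\<psi> \<omega>) 0"
    moreover have "finite (insert 0 (\<Xi> \<omega>) \<inter> cball 0 (2 * real n))"
      using fin by (simp add: Int_insert_left)
    ultimately have "measure lborel (cball (0::'a) (real n)) \<le>
        (\<Sum>\<xi>\<in>insert 0 (\<Xi> \<omega>) \<inter> cball 0 (2 * real n). app \<omega> \<xi>)"
      by (intro far_territory_imp_volume_le_appetites) (auto simp: ennreal_of_nat_eq_real_of_nat)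
    moreover have "measure lborel (cball (0::'a) (real n)) = \<beta> * real n ^ ?d"
      by (simp add: content_cball \<beta>_def)
    ultimately show "t * \<beta> * real n ^ ?d
        \<le> t * (\<Sum>\<xi>\<in>insert 0 (\<Xi> \<omega>) \<inter> cball 0 (2 * real n). app \<omega> \<xi>)"
      using t by (simp add: mult.assoc mult_left_mono)
  qed
  from moment_of_appetite_sum_deviation[OF pp zero_le_one iid subset_insertI order_refl b zero_le_numeral rate this]
  obtain c where c: "0 < c" and moment: "\<And>h K. (\<And>r. 0 \<le> r \<Longrightarrow> h r \<le> K * exp (c * r ^ ?d)) \<Longrightarrow>
      upper_expectation P (\<lambda>\<omega>. extend_top h (territory_radius (\<psi> \<omega>) 0)) < \<infinity>"
    by blast
  have "exp (c * r powr p) \<le> exp c * exp (c * r ^ ?d)" if "0 \<le> r" for r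
  proof -
    have "c * r powr p \<le> c * (1 + r ^ ?d)"
      using powr_le_one_plus_power[OF that p] c by (intro mult_left_mono) auto
    then show ?thesis by (simp add: exp_add[symmetric] distrib_left)
  qed
  then have "upper_expectation P
      (\<lambda>\<omega>. extend_top (\<lambda>r. exp (c * r powr p)) (territory_radius (\<psi> \<omega>) 0)) < \<infinity>"
    by (rule moment)
  with c show ?thesis by (intro exI[of _ c] conjI)
qed

theorem theorem2p1:
  fixes N :: "'s measure" and \<alpha> :: "'s \<Rightarrow> real" and \<mu> \<sigma> :: real
    and P :: "'w measure" and \<Xi> :: "'w \<Rightarrow> 'a::euclidean_space set"
    and app :: "'w \<Rightarrow> 'a \<Rightarrow> real" and \<psi> :: "'w \<Rightarrow> 'a \<Rightarrow> 'a target"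
    and P' :: "'v measure" and \<Xi>' :: "'v \<Rightarrow> 'a set"
    and app' :: "'v \<Rightarrow> 'a \<Rightarrow> real" and \<psi>' :: "'v \<Rightarrow> 'a \<Rightarrow> 'a target"
  assumes "prob_space N" and "\<alpha> \<in> borel_measurable N" and "AE s in N. 0 \<le> \<alpha> s"
  shows
    "(stable_model P 1 (distr N borel \<alpha>) \<Xi> app \<psi> \<and> DIM('a) > 1 \<and>
      integrable N \<alpha> \<and> prob_space.expectation N \<alpha> = \<mu> \<and> \<mu> > 2 ^ DIM('a) \<and>
      integrable N (\<lambda>s. (\<alpha> s)\<^sup>2) \<and> prob_space.variance N \<alpha> = \<sigma>\<^sup>2
      \<longrightarrow> (\<forall>\<delta>. 0 < \<delta> \<and> \<delta> < real DIM('a) \<longrightarrow>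
            upper_expectation P
              (\<lambda>\<omega>. extend_top (\<lambda>r. r powr (real DIM('a) - \<delta>)) (alloc_dist (\<psi> \<omega>) 0)) < \<infinity>))
     \<and>
     (palm_stable_model P' 1 (distr N borel \<alpha>) \<Xi>' app' \<psi>' \<and>
      (\<exists>M. AE s in N. \<alpha> s \<le> M) \<and>
      prob_space.expectation N \<alpha> = \<mu> \<and> \<mu> < 1 / 2 ^ DIM('a) \<and>
      prob_space.variance N \<alpha> = \<sigma>\<^sup>2
      \<longrightarrow> (\<forall>\<epsilon>. 0 < \<epsilon> \<and> \<epsilon> < real DIM('a) / 2 \<longrightarrow>
            (\<exists>c>0. upper_expectation P'
              (\<lambda>\<omega>. extend_top (\<lambda>r. exp (c * r powr \<epsilon>)) (territory_radius (\<psi>' \<omega>) 0)) < \<infinity>)))"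
proof (intro conjI impI allI; elim conjE)
  fix \<delta> :: real
  assume model: "stable_model P 1 (distr N borel \<alpha>) \<Xi> app \<psi>"
    and "integrable N \<alpha>" "integrable N (\<lambda>s. (\<alpha> s)\<^sup>2)"
    and "prob_space.expectation N \<alpha> = \<mu>" "\<mu> > 2 ^ DIM('a)" and "0 < \<delta>" "\<delta> < real DIM('a)"
  then show "upper_expectation P
      (\<lambda>\<omega>. extend_top (\<lambda>r. r powr (real DIM('a) - \<delta>)) (alloc_dist (\<psi> \<omega>) 0)) < \<infinity>"
    by (intro supercritical_site_distance_moment[OF assms(1,3) _ _ _ model]) auto
next
  fix \<epsilon> :: real
  assume model: "palm_stable_model P' 1 (distr N borel \<alpha>) \<Xi>' app' \<psi>'"
    and "\<exists>M. AE s in N. \<alpha> s \<le> M"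
    and \<mu>: "prob_space.expectation N \<alpha> = \<mu>" "\<mu> < 1 / 2 ^ DIM('a)"
    and \<epsilon>: "0 < \<epsilon>" "\<epsilon> < real DIM('a) / 2"
  then obtain A where A: "AE s in N. \<alpha> s \<le> A" by blast
  show "\<exists>c>0. upper_expectation P'
      (\<lambda>\<omega>. extend_top (\<lambda>r. exp (c * r powr \<epsilon>)) (territory_radius (\<psi>' \<omega>) 0)) < \<infinity>"
    by (rule subcritical_territory_radius_moment[OF assms A _ model]) (use \<mu> \<epsilon> in auto)
qed

end
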